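(* Let $w_1,w_2,w_3$ be any positive integers. Then for every integer $n\ge 0$ and every $y\in\mathbb{Z}_p$, \begin{align*} &\sum_{k+l+m=n}\binom{n}{k,l,m}E_{k,\chi}(w_1y)E_{l,\chi}(w_2y)E_{m,\chi}(w_3y)\,w_{3}^{k}w_{1}^{l}w_{2}^{m}\\ =&\sum_{k+l+m=n}\binom{n}{k,l,m}E_{k,\chi}(w_1y)E_{l,\chi}(w_3y)E_{m,\chi}(w_2y)\,w_{2}^{k}w_{1}^{l}w_{3}^{m}. \end{align*} Here each sum is over all nonnegative integers $k,l,m$ with $k+l+m=n$.
   Context: $p$ is a fixed odd prime, $\mathbb{Z}_p$ is the ring of $p$-adic integers, and $\mathbb{C}_p$ is the completion of an algebraic closure of $\mathbb{Q}_p$. $d$ is a fixed odd positive integer and $\chi$ is a (primitive) Dirichlet character of conductor $d$, with values in $\overline{\mathbb{Q}}$, regarded as $\mathbb{C}_p$-valued through a fixed embedding $\overline{\mathbb{Q}}\to\mathbb{C}_p$; as usual $\chi(a)=0$ when $\gcd(a,d)>1$ (and $\chi\equiv 1$ if $d=1$). The generalized Euler polynomials $E_{n,\chi}(x)$ attached to $\chi$ are the polynomials in $x$ defined by $$\frac{2e^{xt}}{e^{dt}+1}\sum_{a=0}^{d-1}(-1)^a\chi(a)e^{at}=\sum_{n=0}^{\infty}E_{n,\chi}(x)\frac{t^n}{n!}.$$ The multinomial coefficient is $\binom{n}{k,l,m}=\frac{n!}{k!\,l!\,m!}$. *)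

theory Defs
  imports "HOL-Analysis.Analysis" "HOL-Computational_Algebra.Computational_Algebra"
begin

text \<open>The \<open>p\<close>-adic absolute value on the rationals, normalised by \<open>\<bar>p\<bar> = 1/p\<close>.\<close>

definition padic_abs :: "nat \<Rightarrow> rat \<Rightarrow> real" where
  "padic_abs p r =
     (if r = 0 then 0
      else real p powi (int (multiplicity (int p) (snd (quotient_of r)))
                        - int (multiplicity (int p) (fst (quotient_of r)))))"

text \<open>
  No \<open>p\<close>-adic field is available in the libraries, so \<open>\<complex>\<^sub>p\<close> enters as any type that is a completion
  of an algebraic closure of a completion of the rationals at \<open>p\<close>. The completions and the
  algebraic closure are taken inside the big field: in a complete field, the topological closure
  of a subfield is a completion of it, and in a field extension of \<open>\<rat>\<^sub>p\<close> the elements algebraic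
  over \<open>\<rat>\<^sub>p\<close> form an algebraic closure of \<open>\<rat>\<^sub>p\<close> as soon as they are algebraically closed.
\<close>

definition Qp :: "'k::{field_char_0, metric_space} set" where
  "Qp = closure (range of_rat)"

definition Zp :: "'k::{field_char_0, metric_space} set" where
  "Zp = closure (range of_int)"

definition Qp_alg :: "'k::{field_char_0, metric_space} set" where
  "Qp_alg = {x. \<exists>f. f \<noteq> 0 \<and> (\<forall>i. coeff f i \<in> Qp) \<and> poly f x = 0}"

text \<open>
  The absolute value of \<open>x\<close> is \<open>dist x 0\<close>: the class of \<open>norm\<close> would force a real vector space.
\<close>

definition is_Cp :: "nat \<Rightarrow> 'k::{field_char_0, complete_space} itself \<Rightarrow> bool" where
  "is_Cp p K \<longleftrightarrow>
     (\<forall>x y :: 'k. dist x y = dist (x - y) 0) \<and>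
     (\<forall>x y :: 'k. dist (x * y) 0 = dist x 0 * dist y 0) \<and>
     (\<forall>x y :: 'k. dist (x + y) 0 \<le> max (dist x 0) (dist y 0)) \<and>
     (\<forall>r. dist (of_rat r :: 'k) 0 = padic_abs p r) \<and>
     (\<forall>f :: 'k poly. degree f > 0 \<and> (\<forall>i. coeff f i \<in> Qp_alg) \<longrightarrow> (\<exists>x\<in>Qp_alg. poly f x = 0)) \<and>
     closure (Qp_alg :: 'k set) = UNIV"

definition dirichlet_character :: "nat \<Rightarrow> (int \<Rightarrow> complex) \<Rightarrow> bool" where
  "dirichlet_character d chi \<longleftrightarrow>
     d > 0 \<and>
     (\<forall>a. chi (a + int d) = chi a) \<and>
     (\<forall>a b. chi (a * b) = chi a * chi b) \<and>
     chi 1 = 1 \<and>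
     (\<forall>a. chi a = 0 \<longleftrightarrow> \<not> coprime a (int d))"

text \<open>
  A character modulo \<open>d\<close> has conductor \<open>d\<close> (is primitive) if it does not factor through the units
  modulo any proper divisor \<open>d'\<close> of \<open>d\<close>, i.e. is nontrivial on units congruent to 1 modulo \<open>d'\<close>.
\<close>

definition primitive_dirichlet_character :: "nat \<Rightarrow> (int \<Rightarrow> complex) \<Rightarrow> bool" where
  "primitive_dirichlet_character d chi \<longleftrightarrow>
     dirichlet_character d chi \<and>
     (\<forall>d'. d' dvd d \<and> d' \<noteq> d \<longrightarrow>
        (\<exists>a. coprime a (int d) \<and> int d' dvd a - 1 \<and> chi a \<noteq> 1))"

text \<open>
  \<open>\<rat>\<close>-bar is the field of algebraic numbers inside the complex numbers; only the values of \<open>\<iota>\<close> on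
  algebraic numbers matter. Injectivity is automatic.
\<close>

definition Qbar_embedding :: "(complex \<Rightarrow> 'k::field_char_0) \<Rightarrow> bool" where
  "Qbar_embedding \<iota> \<longleftrightarrow>
     \<iota> 1 = 1 \<and>
     (\<forall>x y. algebraic x \<and> algebraic y \<longrightarrow> \<iota> (x + y) = \<iota> x + \<iota> y \<and> \<iota> (x * y) = \<iota> x * \<iota> y)"

text \<open>
  The generalised Euler polynomials are read off from the generating function in the ring of power
  series in \<open>t\<close> over the polynomials in \<open>x\<close>; \<open>euler_kernel\<close> is its part not involving \<open>x\<close>.
\<close>

definition euler_kernel :: "nat \<Rightarrow> (int \<Rightarrow> 'k::field_char_0) \<Rightarrow> 'k fps" where
  "euler_kernel d chi =
     2 / (fps_exp (of_nat d) + 1) *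
     (\<Sum>a<d. fps_const ((- 1) ^ a * chi (int a)) * fps_exp (of_nat a))"

definition gen_euler_poly :: "nat \<Rightarrow> (int \<Rightarrow> 'k::field_char_0) \<Rightarrow> nat \<Rightarrow> 'k poly" where
  "gen_euler_poly d chi n =
     fact n * fps_nth (Abs_fps (\<lambda>i. monom (1 / fact i) i)
                       * Abs_fps (\<lambda>i. [: fps_nth (euler_kernel d chi) i :])) n"

lemma gen_euler_poly_generating_function:
  fixes x :: "'k::field_char_0"
  shows "Abs_fps (\<lambda>n. poly (gen_euler_poly d chi n) x / fact n) =
           2 * fps_exp x / (fps_exp (of_nat d) + 1)
           * (\<Sum>a<d. fps_const ((- 1) ^ a * chi (int a)) * fps_exp (of_nat a))"
proof -
  have fact_poly: "poly (fact n) x = fact n" for n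
    by (metis of_nat_fact of_nat_poly poly_pCons mult_zero_right add.right_neutral poly_0)
  have "Abs_fps (\<lambda>n. poly (gen_euler_poly d chi n) x / fact n) = fps_exp x * euler_kernel d chi"
    by (rule fps_ext)
       (simp add: gen_euler_poly_def fact_poly fps_mult_nth poly_sum poly_monom mult.commute)
  moreover have unit: "fps_nth (fps_exp (of_nat d :: 'k) + 1) 0 \<noteq> 0"
    by simp
  ultimately show ?thesis
    by (simp add: euler_kernel_def fps_divide_unit[OF unit] mult_ac)
qed

end

theory Submission
  imports Defs
begin

text \<open>
  The sum over \<open>k + l + m = n\<close> is \<open>n!\<close> times the coefficient of \<open>t\<^sup>n\<close> in a product of three generating
  functions, the one for \<open>E\<^sub>k\<close> being taken at \<open>c t\<close> when it is weighted by \<open>c\<^sup>k\<close>. With \<open>K\<close> the part of the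
  generating function not involving \<open>x\<close>, both sides give
  \<open>exp ((w\<^sub>1 w\<^sub>2 + w\<^sub>1 w\<^sub>3 + w\<^sub>2 w\<^sub>3) y t) K(w\<^sub>1 t) K(w\<^sub>2 t) K(w\<^sub>3 t)\<close>, which is symmetric in the weights.
\<close>

lemma fps_mult3_nth:
  fixes f g h :: "'a::comm_semiring_1 fps"
  shows "fps_nth (f * g * h) n =
    (\<Sum>(k,l,m) \<in> {(k,l,m). k + l + m = n}. fps_nth f k * fps_nth g l * fps_nth h m)"
proof -
  have "fps_nth (f * g * h) n =
      (\<Sum>i=0..n. \<Sum>j=0..n-i. fps_nth f i * fps_nth g j * fps_nth h (n - i - j))"
    unfolding mult.assoc by (simp add: fps_mult_nth sum_distrib_left)
  also have "\<dots> = (\<Sum>(i,j) \<in> (SIGMA i:{0..n}. {0..n-i}).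
      fps_nth f i * fps_nth g j * fps_nth h (n - i - j))"
    by (rule sum.Sigma) auto
  also have "\<dots> = (\<Sum>(k,l,m) \<in> {(k,l,m). k + l + m = n}.
      fps_nth f k * fps_nth g l * fps_nth h m)"
    \<comment> \<open>The subtraction on naturals never truncates, since \<open>k \<le> n\<close>
      and \<open>l \<le> n - k\<close>.\<close>
    by (rule sum.reindex_bij_witness[where i = "\<lambda>(k,l,m). (k,l)" and j = "\<lambda>(k,l). (k,l,n-k-l)"])
      auto
  finally show ?thesis .
qed

lemma gen_euler_poly_scaled_generating_function:
  fixes c x :: "'k::field_char_0"
  shows "Abs_fps (\<lambda>k. poly (gen_euler_poly d chi k) x * c ^ k / fact k) =
    fps_exp (c * x) * (euler_kernel d chi oo (fps_const c * fps_X))"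
proof -
  \<comment> \<open>The constant term is 2, so dividing is multiplying by an inverse and
    \<open>fps_exp x\<close> can be pulled out of the quotient.\<close>
  have unit: "fps_nth (fps_exp (of_nat d :: 'k) + 1) 0 \<noteq> 0"
    by simp
  have "Abs_fps (\<lambda>k. poly (gen_euler_poly d chi k) x / fact k) = fps_exp x * euler_kernel d chi"
    unfolding gen_euler_poly_generating_function euler_kernel_def
    by (simp add: fps_divide_unit[OF unit] mult_ac)
  then have "Abs_fps (\<lambda>k. poly (gen_euler_poly d chi k) x / fact k) oo (fps_const c * fps_X) =
      fps_exp (c * x) * (euler_kernel d chi oo (fps_const c * fps_X))"
    by (simp add: fps_compose_mult_distrib)
  then show ?thesis
    unfolding fps_compose_linear by (simp add: mult.commute)
qed

text \<open>Arguments and weights are kept independent, so that both sides of the identity are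
  instances.\<close>

lemma gen_euler_poly_multinomial_sum:
  fixes a b c x y z :: "'k::field_char_0"
    and d :: nat and chi :: "int \<Rightarrow> 'k"
  defines "K \<equiv> euler_kernel d chi"
  shows "(\<Sum>(k,l,m) \<in> {(k,l,m). k + l + m = n}.
      fact n / (fact k * fact l * fact m)
      * poly (gen_euler_poly d chi k) x * poly (gen_euler_poly d chi l) y
      * poly (gen_euler_poly d chi m) z * a ^ k * b ^ l * c ^ m) =
    fact n * fps_nth (fps_exp (a * x + b * y + c * z)
      * ((K oo (fps_const a * fps_X)) * (K oo (fps_const b * fps_X)) * (K oo (fps_const c * fps_X)))) n"
proof -
  let ?G = "\<lambda>c x. Abs_fps (\<lambda>k. poly (gen_euler_poly d chi k) x * c ^ k / fact k)"
  have "fps_exp (a * x + b * y + c * z)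
      * ((K oo (fps_const a * fps_X)) * (K oo (fps_const b * fps_X)) * (K oo (fps_const c * fps_X)))
      = ?G a x * ?G b y * ?G c z"
    unfolding gen_euler_poly_scaled_generating_function K_def
    by (simp add: fps_exp_add_mult mult_ac)
  then show ?thesis
    by (simp only: fps_mult3_nth sum_distrib_left) (rule sum.cong, auto)
qed

theorem theorem4p7:
  fixes p d w1 w2 w3 n :: nat
    and chi :: "int \<Rightarrow> complex"
    and \<iota> :: "complex \<Rightarrow> 'k::{field_char_0, complete_space}"
    and y :: 'k
    and E :: "nat \<Rightarrow> 'k \<Rightarrow> 'k"
  defines "E \<equiv> \<lambda>k x. poly (gen_euler_poly d (\<iota> \<circ> chi) k) x"
  assumes "prime p" and "odd p"
    and "is_Cp p TYPE('k)"
    and "odd d" and "primitive_dirichlet_character d chi"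
    and "Qbar_embedding \<iota>"
    and "w1 > 0" and "w2 > 0" and "w3 > 0"
    and "y \<in> Zp"
  shows
    "(\<Sum>(k,l,m) \<in> {(k,l,m). k + l + m = n}.
        fact n / (fact k * fact l * fact m)
        * E k (of_nat w1 * y) * E l (of_nat w2 * y) * E m (of_nat w3 * y)
        * of_nat w3 ^ k * of_nat w1 ^ l * of_nat w2 ^ m)
   = (\<Sum>(k,l,m) \<in> {(k,l,m). k + l + m = n}.
        fact n / (fact k * fact l * fact m)
        * E k (of_nat w1 * y) * E l (of_nat w3 * y) * E m (of_nat w2 * y)
        * of_nat w2 ^ k * of_nat w1 ^ l * of_nat w3 ^ m)"
  \<comment> \<open>The weights are \<open>(w3, w1, w2)\<close> on the left and
    \<open>(w2, w1, w3)\<close> on the right; either way each pair of distinct \<open>w\<close>'s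
    meets once in the exponent.\<close>
  unfolding E_def gen_euler_poly_multinomial_sum by (simp only: mult_ac add_ac)

end
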